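(* Let $G$ satisfy: for some $\alpha\in(0,1)$, $G\in C^{2,\alpha}([-1,1])$, $G\ge0$, $G(t)=0$ only for $t=\pm1$, and $G''(\pm1)>0$; and let $f=-G'$. Let $u$ be a solution of $$\Delta u=0\ \text{ in }\mathbb{R}^2_+=\{(x,y):x\in\mathbb{R},\,y>0\},\qquad \partial_\nu u=f(u)\ \text{ on }\partial\mathbb{R}^2_+,$$ such that $-1\le u\le1$ and $u(x,0)\to-1$ as $x\to\pm\infty$ (i.e. both as $x\to+\infty$ and as $x\to-\infty$). Then $u\equiv-1$.
   Context: $\nu$ is the outer unit normal to $\mathbb{R}^2_+$, so $\partial_\nu u=-u_y$ on $\partial\mathbb{R}^2_+=\mathbb{R}\times\{0\}$. *)

theory Defs
  imports "HOL-Analysis.Analysis"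
begin

text \<open>
  Derivatives are taken within a set, so that they are one-sided at boundary points. For the sets
  used here (intervals, the open and the closed half-plane) such derivatives are unique, so the
  choice operators in \<^const>\<open>vector_derivative\<close> and \<^const>\<open>frechet_derivative\<close> are harmless; and
  within the open half-plane they are the ordinary derivatives. Values of a function outside the
  set play no role.
\<close>

definition deriv_within :: "real set \<Rightarrow> (real \<Rightarrow> real) \<Rightarrow> real \<Rightarrow> real" where
  "deriv_within S g t = vector_derivative g (at t within S)"

definition holder_on :: "real \<Rightarrow> real set \<Rightarrow> (real \<Rightarrow> real) \<Rightarrow> bool" where
  "holder_on \<alpha> S g \<longleftrightarrow> (\<exists>C. \<forall>s\<in>S. \<forall>t\<in>S. \<bar>g s - g t\<bar> \<le> C * \<bar>s - t\<bar> powr \<alpha>)"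

text \<open>The class \<open>C\<^sup>2\<^sup>,\<^sup>\<alpha>(S)\<close> for a compact interval \<open>S\<close>; continuity of the derivatives
  is implied.\<close>

definition C2_holder_on :: "real \<Rightarrow> real set \<Rightarrow> (real \<Rightarrow> real) \<Rightarrow> bool" where
  "C2_holder_on \<alpha> S g \<longleftrightarrow>
     g differentiable_on S \<and> deriv_within S g differentiable_on S \<and>
     holder_on \<alpha> S (deriv_within S (deriv_within S g))"

definition dir_deriv ::
  "'a::euclidean_space set \<Rightarrow> 'a \<Rightarrow> ('a \<Rightarrow> real) \<Rightarrow> 'a \<Rightarrow> real" where
  "dir_deriv S v u z = frechet_derivative u (at z within S) v"

definition C1_on :: "'a::euclidean_space set \<Rightarrow> ('a \<Rightarrow> real) \<Rightarrow> bool" where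
  "C1_on S u \<longleftrightarrow> u differentiable_on S \<and> (\<forall>b\<in>Basis. continuous_on S (dir_deriv S b u))"

definition C2_on :: "'a::euclidean_space set \<Rightarrow> ('a \<Rightarrow> real) \<Rightarrow> bool" where
  "C2_on S u \<longleftrightarrow> C1_on S u \<and> (\<forall>b\<in>Basis. C1_on S (dir_deriv S b u))"

definition laplacian :: "'a::euclidean_space set \<Rightarrow> ('a \<Rightarrow> real) \<Rightarrow> 'a \<Rightarrow> real" where
  "laplacian S u z = (\<Sum>b\<in>Basis. dir_deriv S b (dir_deriv S b u) z)"

definition half_plane :: "(real \<times> real) set" where
  "half_plane = {(x, y). y > 0}"

definition closed_half_plane :: "(real \<times> real) set" where
  "closed_half_plane = {(x, y). y \<ge> 0}"

text \<open>The derivative along the outer unit normal \<open>(0, -1)\<close> at the boundary point \<open>(x, 0)\<close>,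
  i.e. \<open>-u\<^sub>y(x, 0)\<close>.\<close>

definition normal_deriv :: "(real \<times> real \<Rightarrow> real) \<Rightarrow> real \<Rightarrow> real" where
  "normal_deriv u x = dir_deriv closed_half_plane (0, -1) u (x, 0)"

text \<open>Classical solutions: \<open>C\<^sup>2\<close> in the open half-plane and \<open>C\<^sup>1\<close> up to the boundary.\<close>

definition boundary_reaction_solution ::
  "(real \<Rightarrow> real) \<Rightarrow> (real \<times> real \<Rightarrow> real) \<Rightarrow> bool" where
  "boundary_reaction_solution f u \<longleftrightarrow>
     C2_on half_plane u \<and> C1_on closed_half_plane u \<and>
     (\<forall>z\<in>half_plane. laplacian half_plane u z = 0) \<and>
     (\<forall>x. normal_deriv u x = f (u (x, 0)))"

end

theory Submission
  imports Defs
begin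

text \<open>
  Put \<open>v = u + 1\<close> and let \<open>\<phi>\<close> be a cutoff at scale \<open>R\<close>. Testing \<open>\<Delta>u = 0\<close> with \<open>v \<phi>\<^sup>2\<close> leaves the
  boundary term \<open>\<integral> v \<phi>\<^sup>2 G'(u)\<close>, which dominates \<open>\<integral> \<phi>\<^sup>2 G(u)\<close> up to a constant because \<open>G\<close> is
  convex near \<open>-1\<close>; the error \<open>\<integral> v\<^sup>2 |\<nabla>\<phi>|\<^sup>2\<close> is bounded since the domain is two-dimensional. Hence
  both \<open>\<integral> |\<nabla>u|\<^sup>2\<close> and \<open>\<integral> G(u(x, 0)) dx\<close> are finite. With \<open>X = (x, y)\<close>, the Pohozaev field
  \<open>|\<nabla>u|\<^sup>2 X / 2 - (X \<cdot> \<nabla>u) \<nabla>u\<close> is divergence free in dimension two; integrating it against \<open>\<phi>\<close> bounds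
  \<open>\<integral> \<phi> G(u(x, 0)) dx\<close> by the tails of these two integrals. So \<open>G(u) = 0\<close> on the boundary, and
  \<open>u = -1\<close> there by continuity. Then the boundary term of the first identity vanishes, the finite
  energy makes the error term tend to \<open>0\<close>, and \<open>u\<close> is constant.
\<close>

section \<open>Calculus on the half-plane: mixed partials and the divergence theorem\<close>

text \<open>Integrating \<open>q\<close> vertically recovers a difference of values of
  \<open>u\<close>. Differentiating this in x under the integral sign, which continuity of
  \<open>c\<close> permits, writes \<open>p (x, t) - p (x, y0)\<close> as an integral of
  \<open>c\<close>; its derivative in t is then \<open>c\<close>.\<close>

lemma mixed_partials_commute:
  fixes u p q b c :: "real \<times> real \<Rightarrow> real"
  assumes u_x: "\<And>x y. y > 0 \<Longrightarrow> ((\<lambda>x. u (x, y)) has_real_derivative p (x, y)) (at x)"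
    and u_y: "\<And>x y. y > 0 \<Longrightarrow> ((\<lambda>y. u (x, y)) has_real_derivative q (x, y)) (at y)"
    and p_y: "\<And>x y. y > 0 \<Longrightarrow> ((\<lambda>y. p (x, y)) has_real_derivative b (x, y)) (at y)"
    and q_x: "\<And>x y. y > 0 \<Longrightarrow> ((\<lambda>x. q (x, y)) has_real_derivative c (x, y)) (at x)"
    and cont: "continuous_on half_plane c"
    and y: "y > 0"
  shows "b (x, y) = c (x, y)"
proof -
  \<comment> \<open>The base height lies strictly between 0 and \<open>y\<close>, since no
    derivatives are available at height 0.\<close>
  define y0 where "y0 = y / 2"
  have y0: "0 < y0" "y0 < y" using y by (auto simp: y0_def)
  have eq: "p (x, t) - p (x, y0) = integral {y0..t} (\<lambda>s. c (x, s))" if t: "y0 \<le> t" for t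
  proof -
    have FTC: "((\<lambda>s. q (z, s)) has_integral (u (z, t) - u (z, y0))) {y0..t}" for z
      by (rule fundamental_theorem_of_calculus)
        (use t y0 in \<open>auto intro!: has_field_derivative_at_within[OF u_y]
           simp: has_real_derivative_iff_has_vector_derivative[symmetric]\<close>)
    have "((\<lambda>z. integral (cbox y0 t) (\<lambda>s. q (z, s))) has_real_derivative
             integral (cbox y0 t) (\<lambda>s. c (x, s))) (at x within UNIV)"
    proof (rule leibniz_rule_field_derivative)
      show "continuous_on (UNIV \<times> cbox y0 t) (\<lambda>(z, s). c (z, s))"
        by (rule continuous_on_subset[OF cont, THEN continuous_on_eq]) 
           (use y0 in \<open>auto simp: half_plane_def\<close>)
    qed (use FTC y0 q_x in \<open>auto simp: integrable_on_def\<close>)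
    moreover have "(\<lambda>z. integral (cbox y0 t) (\<lambda>s. q (z, s))) = (\<lambda>z. u (z, t) - u (z, y0))"
      using FTC by (auto simp: integral_unique)
    ultimately have "((\<lambda>z. u (z, t) - u (z, y0)) has_real_derivative integral {y0..t} (\<lambda>s. c (x, s))) (at x)"
      by simp
    moreover have "((\<lambda>z. u (z, t) - u (z, y0)) has_real_derivative p (x, t) - p (x, y0)) (at x)"
      using t y0 by (intro DERIV_diff u_x) auto
    ultimately show ?thesis by (rule DERIV_unique[symmetric])
  qed
  have "continuous_on {y0..y + 1} (\<lambda>s. c (x, s))"
    by (rule continuous_on_compose2[OF cont])
      (use y0 in \<open>auto intro!: continuous_intros simp: half_plane_def\<close>)
  then have "((\<lambda>t. integral {y0..t} (\<lambda>s. c (x, s))) has_real_derivative c (x, y)) (at y within {y0..y + 1})"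
    by (rule integral_has_real_derivative) (use y0 in auto)
  then have "((\<lambda>t. p (x, y0) + integral {y0..t} (\<lambda>s. c (x, s))) has_real_derivative 0 + c (x, y)) (at y)"
    by (intro DERIV_add DERIV_const) (use y0 in \<open>simp add: at_within_Icc_at\<close>)
  then have "((\<lambda>t. p (x, t)) has_real_derivative c (x, y)) (at y)"
    by (simp, elim has_field_derivative_transform_within_open[where S = "{y0<..}"])
      (use y0 in \<open>auto simp: eq[symmetric]\<close>)
  then show ?thesis using p_y[OF y] by (rule DERIV_unique[symmetric])
qed

text \<open>The fields used later contain second derivatives of \<open>u\<close>, which need not
  extend to the boundary; only their divergence \<open>g\<close> is continuous up to it. So the
  horizontal integral \<open>J\<close> of \<open>Q\<close> is differentiated at positive heights
  only: there \<open>Px\<close> integrates to 0 because \<open>P\<close> vanishes at both ends, so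
  the derivative of \<open>J\<close> is the integral of \<open>g\<close>. Continuity of
  \<open>J\<close> down to height 0 then suffices for the fundamental theorem.\<close>

lemma integral_divergence_half_plane:
  fixes P Q Px Qy g :: "real \<times> real \<Rightarrow> real"
  assumes A: "0 \<le> A" and B: "0 \<le> B"
    and P: "\<And>x y. y > 0 \<Longrightarrow> ((\<lambda>x. P (x, y)) has_real_derivative Px (x, y)) (at x)"
    and Q: "\<And>x y. y > 0 \<Longrightarrow> ((\<lambda>y. Q (x, y)) has_real_derivative Qy (x, y)) (at y)"
    and Q_cont: "continuous_on closed_half_plane Q"
    and Qy_cont: "continuous_on half_plane Qy"
    and g_cont: "continuous_on closed_half_plane g"
    and div: "\<And>x y. y > 0 \<Longrightarrow> g (x, y) = Px (x, y) + Qy (x, y)"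
    and P0: "\<And>y. P (- A, y) = 0" "\<And>y. P (A, y) = 0"
    and Q0: "\<And>x. Q (x, B) = 0"
  shows "integral (cbox (- A, 0) (A, B)) g = - integral {- A..A} (\<lambda>x. Q (x, 0))"
proof -
  define J where "J y = integral (cbox (- A) A) (\<lambda>x. Q (x, y))" for y
  have J_cont: "continuous_on {0..B} J"
    unfolding J_def
    by (rule integral_continuous_on_param)
       (auto intro!: continuous_intros continuous_on_compose2[OF Q_cont] 
         simp: closed_half_plane_def split_beta)
  have J_deriv: "(J has_real_derivative integral (cbox (- A) A) (\<lambda>x. g (x, y))) (at y)" if "y > 0" for y
  proof -
    have "((\<lambda>y. integral (cbox (- A) A) (\<lambda>x. Q (x, y))) has_real_derivative
             integral (cbox (- A) A) (\<lambda>x. Qy (x, y))) (at y within {0<..})"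
    proof (rule leibniz_rule_field_derivative)
      show "((\<lambda>y. Q (x, y)) has_real_derivative Qy (x, y)) (at y within {0<..})"
        if "y \<in> {0<..}" for x y
        using Q that by (auto intro: has_field_derivative_at_within)
      show "(\<lambda>x. Q (x, y)) integrable_on cbox (- A) A" if "y \<in> {0<..}" for y
        using that by (intro integrable_continuous continuous_intros 
            continuous_on_compose2[OF Q_cont]) (auto simp: closed_half_plane_def)
      show "continuous_on ({0<..} \<times> cbox (- A) A) (\<lambda>(y, x). Qy (x, y))"
        by (auto intro!: continuous_intros continuous_on_compose2[OF Qy_cont] 
           simp: half_plane_def split_beta)
    qed (use that in auto)
    then have "(J has_real_derivative integral (cbox (- A) A) (\<lambda>x. Qy (x, y))) (at y)"
      using at_within_open[of y "{0<..}"] that unfolding J_def by auto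
    moreover have "integral (cbox (- A) A) (\<lambda>x. Qy (x, y)) = integral (cbox (- A) A) (\<lambda>x. g (x, y))"
    proof -
      have "((\<lambda>x. Px (x, y)) has_integral (P (A, y) - P (- A, y))) {- A..A}"
        by (rule fundamental_theorem_of_calculus)
          (use A that in \<open>auto intro!: has_field_derivative_at_within[OF P]
             simp: has_real_derivative_iff_has_vector_derivative[symmetric]\<close>)
      moreover have "((\<lambda>x. g (x, y)) has_integral integral {- A..A} (\<lambda>x. g (x, y))) {- A..A}"
        using that by (intro integrable_integral integrable_continuous_real continuous_intros 
            continuous_on_compose2[OF g_cont]) (auto simp: closed_half_plane_def)
      ultimately have "((\<lambda>x. g (x, y) - Px (x, y)) has_integral integral {- A..A} (\<lambda>x. g (x, y)) - 0) {- A..A}"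
        using P0 by (metis has_integral_diff diff_self)
      then show ?thesis
        using div[OF that] by (simp add: integral_unique)
    qed
    ultimately show ?thesis by simp
  qed
  have "((\<lambda>y. integral (cbox (- A) A) (\<lambda>x. g (x, y))) has_integral (J B - J 0)) {0..B}"
    by (rule fundamental_theorem_of_calculus_interior)
      (use B J_cont J_deriv in \<open>auto simp: has_real_derivative_iff_has_vector_derivative[symmetric]\<close>)
  then have "integral {0..B} (\<lambda>y. integral (cbox (- A) A) (\<lambda>x. g (x, y))) = J B - J 0"
    by (rule integral_unique)
  moreover have "integral (cbox (- A, 0) (A, B)) g =
      integral {0..B} (\<lambda>y. integral (cbox (- A) A) (\<lambda>x. g (x, y)))"
  proof -
    have c: "continuous_on (cbox (- A, 0) (A, B)) g"
      by (rule continuous_on_subset[OF g_cont]) (auto simp: closed_half_plane_def cbox_Pair_eq)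
    then show ?thesis
      using integral_prod_continuous[OF c] integral_swap_continuous[of "-A" 0 A B "\<lambda>x y. g (x, y)"]
      by simp
  qed
  moreover have "J B = 0" using Q0 by (simp add: J_def)
  ultimately show ?thesis by (simp add: J_def)
qed

section \<open>Cutoff functions and half-boxes\<close>

text \<open>A plateau of height 1 for |t| \<le> 1 that reaches 0 at t^2 = 2. Nesting squares of
  positive parts makes it continuously differentiable with an explicit derivative.\<close>

definition cutoff :: "real \<Rightarrow> real" where
  "cutoff t = (max 0 (1 - (max 0 (t\<^sup>2 - 1))\<^sup>2))\<^sup>2"

definition cutoff_deriv :: "real \<Rightarrow> real" where
  "cutoff_deriv t = - 8 * t * max 0 (t\<^sup>2 - 1) * max 0 (1 - (max 0 (t\<^sup>2 - 1))\<^sup>2)"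

lemma has_real_derivative_max_0_power2:
  "((\<lambda>s::real. (max 0 s)\<^sup>2) has_real_derivative 2 * max 0 s) (at s)"
proof -
  consider "s < 0" | "s = 0" | "s > 0" by linarith
  then show ?thesis
  proof cases
    case 1
    have "((\<lambda>s::real. 0) has_real_derivative 2 * max 0 s) (at s)" using 1 by simp
    then show ?thesis
      by (rule has_field_derivative_transform_within_open[where S="{..<0}"]) (use 1 in auto)
  next
    case 3
    have "((\<lambda>s::real. s\<^sup>2) has_real_derivative 2 * max 0 s) (at s)" 
      using 3 by (auto intro!: derivative_eq_intros)
    then show ?thesis
      by (rule has_field_derivative_transform_within_open[where S="{0<..}"]) (use 3 in auto)
  next
    case 2
    have "((\<lambda>h::real. (max 0 h)\<^sup>2 / h) \<longlongrightarrow> 0) (at 0)"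
    proof (rule Lim_null_comparison)
      show "\<forall>\<^sub>F h::real in at 0. norm ((max 0 h)\<^sup>2 / h) \<le> \<bar>h\<bar>"
        by (rule always_eventually) (auto simp: max_def power2_eq_square)
      show "((\<lambda>h::real. \<bar>h\<bar>) \<longlongrightarrow> 0) (at 0)"
        by (rule tendsto_eq_intros | simp)+
    qed
    with 2 show ?thesis by (simp add: has_field_derivative_iff)
  qed
qed

lemma cutoff_has_derivative: "(cutoff has_real_derivative cutoff_deriv t) (at t)"
proof -
  note sq = DERIV_chain2[OF has_real_derivative_max_0_power2]
  have "((\<lambda>t. (max 0 (1 - (max 0 (t\<^sup>2 - 1))\<^sup>2))\<^sup>2) has_real_derivative
          2 * max 0 (1 - (max 0 (t\<^sup>2 - 1))\<^sup>2) * (0 - 2 * max 0 (t\<^sup>2 - 1) * (2 * t))) (at t)"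
    by (rule sq, rule DERIV_diff[OF DERIV_const], rule sq) (auto intro!: derivative_eq_intros)
  then show ?thesis
    by (simp add: cutoff_def[abs_def] cutoff_deriv_def algebra_simps)
qed

lemma continuous_on_cutoff: "continuous_on S cutoff"
  unfolding cutoff_def by (intro continuous_intros)

lemma continuous_on_cutoff_deriv: "continuous_on S cutoff_deriv"
  unfolding cutoff_deriv_def by (intro continuous_intros)

lemma cutoff_nonneg: "0 \<le> cutoff t"
  by (simp add: cutoff_def)

lemma cutoff_le_1: "cutoff t \<le> 1"
  by (auto simp: cutoff_def max_def intro!: power_le_one)

lemma cutoff_eq_1: "\<bar>t\<bar> \<le> 1 \<Longrightarrow> cutoff t = 1"
  using abs_le_square_iff[of t 1] by (simp add: cutoff_def)

lemma cutoff_deriv_eq_0: "\<bar>t\<bar> \<le> 1 \<Longrightarrow> cutoff_deriv t = 0"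
  using abs_le_square_iff[of t 1] by (simp add: cutoff_deriv_def)

lemma cutoff_outside:
  assumes "\<bar>t\<bar> \<ge> 2"
  shows "cutoff t = 0" "cutoff_deriv t = 0"
proof -
  have "t\<^sup>2 \<ge> 4" using abs_le_square_iff[of 2 t] assms by simp
  then have "(max 0 (t\<^sup>2 - 1))\<^sup>2 \<ge> 1" by (simp add: max_def)
  then show "cutoff t = 0" "cutoff_deriv t = 0" by (auto simp: cutoff_def cutoff_deriv_def)
qed

text \<open>For |t| < 2 the bound is the product of 8, the bound 2 on |t|, and the bound 1 on the
  two remaining factors together; elsewhere the derivative is 0.\<close>

lemma cutoff_deriv_bound: "\<bar>cutoff_deriv t\<bar> \<le> 16"
proof (cases "\<bar>t\<bar> \<ge> 2")
  case False
  define m where "m = max 0 (t\<^sup>2 - 1)"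
  have "m * max 0 (1 - m\<^sup>2) \<le> 1"
  proof (cases "m \<le> 1")
    case True
    then show ?thesis by (intro mult_le_one) (auto simp: m_def)
  next
    case False
    then show ?thesis by (simp add: max_def abs_square_le_1)
  qed
  then have "\<bar>t\<bar> * (m * max 0 (1 - m\<^sup>2)) \<le> 2 * 1"
    using False by (intro mult_mono) (auto simp: m_def)
  then show ?thesis
    by (simp add: cutoff_deriv_def m_def[symmetric] abs_mult) (auto simp: m_def algebra_simps)
qed (simp add: cutoff_outside)

text \<open>Rectangles instead of half-discs let Fubini and the divergence theorem work in Cartesian
  coordinates. The area 2 R^2 exactly compensates the factor 1/R^2 of a squared cutoff
  gradient.\<close>

definition half_box :: "real \<Rightarrow> (real \<times> real) set" where
  "half_box R = cbox (- R, 0) (R, R)"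

lemma mem_half_box: "(x, y) \<in> half_box R \<longleftrightarrow> \<bar>x\<bar> \<le> R \<and> 0 \<le> y \<and> y \<le> R"
  by (auto simp: half_box_def cbox_Pair_eq)

lemma half_box_subset: "half_box R \<subseteq> closed_half_plane"
  by (auto simp: mem_half_box closed_half_plane_def)

lemma half_box_mono: "R \<le> S \<Longrightarrow> half_box R \<subseteq> half_box S"
  by (auto simp: mem_half_box)

lemma integrable_half_box:
  "continuous_on closed_half_plane (g :: _ \<Rightarrow> real) \<Longrightarrow> g integrable_on half_box R"
  unfolding half_box_def
  by (rule integrable_continuous) (metis continuous_on_subset half_box_def half_box_subset)

lemma integral_const_half_box: "0 \<le> R \<Longrightarrow> integral (half_box R) (\<lambda>z. c) = 2 * R\<^sup>2 * (c::real)"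
  by (simp add: half_box_def content_Pair power2_eq_square)

text \<open>This is 1 on \<open>half_box R\<close> and 0 on the lateral and top sides of
  \<open>half_box (2 * R)\<close>. It does not vanish on the whole bottom edge, so the boundary
  condition enters every identity tested with it.\<close>

definition bump :: "real \<Rightarrow> real \<times> real \<Rightarrow> real" where
  "bump R z = cutoff (fst z / R) * cutoff (snd z / R)"

definition bump_x :: "real \<Rightarrow> real \<times> real \<Rightarrow> real" where
  "bump_x R z = cutoff_deriv (fst z / R) / R * cutoff (snd z / R)"

definition bump_y :: "real \<Rightarrow> real \<times> real \<Rightarrow> real" where
  "bump_y R z = cutoff (fst z / R) * (cutoff_deriv (snd z / R) / R)"

lemma cutoff_divide_has_derivative:
  "((\<lambda>x. cutoff (x / R)) has_real_derivative cutoff_deriv (x / R) / R) (at x)"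
proof -
  have "((\<lambda>x. x / R) has_real_derivative 1 / R) (at x)"
    by (auto intro!: DERIV_cdivide DERIV_ident)
  from DERIV_chain2[OF cutoff_has_derivative this] show ?thesis by simp
qed

lemma bump_has_derivative_x: "((\<lambda>x. bump R (x, y)) has_real_derivative bump_x R (x, y)) (at x)"
  using DERIV_cmult_right[OF cutoff_divide_has_derivative[of R x], of "cutoff (y / R)"]
  by (simp add: bump_def bump_x_def)

lemma bump_has_derivative_y: "((\<lambda>y. bump R (x, y)) has_real_derivative bump_y R (x, y)) (at y)"
  using DERIV_cmult[OF cutoff_divide_has_derivative[of R y], of "cutoff (x / R)"]
  by (simp add: bump_def bump_y_def)

lemma continuous_on_bump:
  assumes "R > 0"
  shows "continuous_on S (bump R)" "continuous_on S (bump_x R)" "continuous_on S (bump_y R)"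
  unfolding bump_def bump_x_def bump_y_def
  by (intro continuous_intros continuous_on_compose2[OF continuous_on_cutoff[of UNIV]]
      continuous_on_compose2[OF continuous_on_cutoff_deriv[of UNIV]]; use assms in auto)+

lemma bump_nonneg: "0 \<le> bump R z"
  by (simp add: bump_def cutoff_nonneg)

lemma bump_le_1: "bump R z \<le> 1"
  by (simp add: bump_def cutoff_nonneg cutoff_le_1 mult_le_one)

lemma bump_eq_1: "z \<in> half_box R \<Longrightarrow> R > 0 \<Longrightarrow> bump R z = 1"
  by (cases z) (auto simp: bump_def mem_half_box cutoff_eq_1)

lemma bump_deriv_eq_0:
  assumes "z \<in> half_box R" "R > 0"
  shows "bump_x R z = 0" "bump_y R z = 0"
  using assms by (cases z; auto simp: bump_x_def bump_y_def mem_half_box cutoff_deriv_eq_0)+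

lemma bump_deriv_bound:
  assumes "R > 0"
  shows "\<bar>bump_x R z\<bar> \<le> 16 / R" "\<bar>bump_y R z\<bar> \<le> 16 / R"
proof -
  have "\<bar>cutoff_deriv s\<bar> / R * cutoff t \<le> 16 / R * 1" for s t
    using assms cutoff_deriv_bound[of s] cutoff_nonneg[of t] cutoff_le_1[of t]
    by (intro mult_mono divide_right_mono) auto
  then show "\<bar>bump_x R z\<bar> \<le> 16 / R" "\<bar>bump_y R z\<bar> \<le> 16 / R"
    using assms by (auto simp: bump_x_def bump_y_def abs_mult cutoff_nonneg mult.commute)
qed

lemma bump_outside:
  assumes "R > 0"
  shows "bump R (- (2 * R), y) = 0" "bump R (2 * R, y) = 0" "bump R (x, 2 * R) = 0"
  using assms by (auto simp: bump_def cutoff_outside)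

text \<open>Pointwise, |h| is at most \<open>g\<close> times the indicator of \<open>T - S\<close>.
  In the applications \<open>h\<close> contains derivatives of the cutoff, hence vanishes on the
  inner region, and the error becomes an increment of a monotone quantity between the scales R and 2
  R.\<close>

lemma abs_integral_le_tail:
  fixes g h :: "'a::euclidean_space \<Rightarrow> real"
  assumes "S \<subseteq> T" and h: "h integrable_on T" and g: "g integrable_on S" "g integrable_on T"
    and 0: "\<And>z. z \<in> S \<Longrightarrow> h z = 0" and bound: "\<And>z. z \<in> T - S \<Longrightarrow> \<bar>h z\<bar> \<le> g z"
  shows "\<bar>integral T h\<bar> \<le> integral T g - integral S g"
proof -
  have ST: "S \<inter> T = S" using assms(1) by auto
  define k where "k z = g z - (if z \<in> S then g z else 0)" for z
  have S: "(\<lambda>z. if z \<in> S then g z else 0) integrable_on T"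
    using integrable_restrict_Int[of S g T] g ST by simp
  have "norm (integral T h) \<le> integral T k"
    by (rule integral_norm_bound_integral)
      (use h g S 0 bound in \<open>auto simp: k_def[abs_def] intro: integrable_diff\<close>)
  also have "integral T k = integral T g - integral S g"
    using g S integral_restrict_Int[of T S g] ST by (simp add: k_def[abs_def] integral_diff)
  finally show ?thesis by simp
qed

section \<open>Caccioppoli and Pohozaev identities for harmonic functions\<close>

text \<open>Here \<open>p\<close>, \<open>q\<close> are the first partials, continuous up to the
  boundary, and \<open>a\<close>, \<open>b\<close> are u_xx and u_xy in the open half-plane.
  Harmonicity is encoded by using \<open>- a\<close> for u_yy, and symmetry of the Hessian by using
  \<open>b\<close> for both mixed partials.\<close>

locale half_plane_harmonic =
  fixes u p q a b :: "real \<times> real \<Rightarrow> real"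
  assumes cont: "continuous_on closed_half_plane u" "continuous_on closed_half_plane p"
      "continuous_on closed_half_plane q" "continuous_on half_plane a" "continuous_on half_plane b"
    and u_x: "\<And>x y. y > 0 \<Longrightarrow> ((\<lambda>x. u (x, y)) has_real_derivative p (x, y)) (at x)"
    and u_y: "\<And>x y. y > 0 \<Longrightarrow> ((\<lambda>y. u (x, y)) has_real_derivative q (x, y)) (at y)"
    and p_x: "\<And>x y. y > 0 \<Longrightarrow> ((\<lambda>x. p (x, y)) has_real_derivative a (x, y)) (at x)"
    and p_y: "\<And>x y. y > 0 \<Longrightarrow> ((\<lambda>y. p (x, y)) has_real_derivative b (x, y)) (at y)"
    and q_x: "\<And>x y. y > 0 \<Longrightarrow> ((\<lambda>x. q (x, y)) has_real_derivative b (x, y)) (at x)"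
    and q_y: "\<And>x y. y > 0 \<Longrightarrow> ((\<lambda>y. q (x, y)) has_real_derivative - a (x, y)) (at y)"
begin

definition energy_density :: "real \<times> real \<Rightarrow> real" where
  "energy_density z = (p z)\<^sup>2 + (q z)\<^sup>2"

definition energy :: "real \<Rightarrow> real" where
  "energy R = integral (half_box R) energy_density"

lemma half_plane_subset: "half_plane \<subseteq> closed_half_plane"
  by (auto simp: half_plane_def closed_half_plane_def)

lemmas cont_open = cont(1-3)[THEN continuous_on_subset, OF half_plane_subset] cont(4,5)

lemma continuous_on_energy_density: "continuous_on closed_half_plane energy_density"
  unfolding energy_density_def by (intro continuous_intros cont)

lemma energy_density_nonneg: "0 \<le> energy_density z"
  by (simp add: energy_density_def)

lemma energy_mono: "R \<le> S \<Longrightarrow> energy R \<le> energy S"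
  unfolding energy_def
  by (intro integral_subset_le half_box_mono integrable_half_box continuous_on_energy_density)
     (auto simp: energy_density_nonneg)

text \<open>Divergence theorem for the field (u - k) bump^2 grad u. The second derivatives cancel by
  harmonicity, and only the bottom side of the box contributes.\<close>

lemma caccioppoli_identity:
  assumes R: "R > 0"
  shows "integral (half_box (2 * R))
      (\<lambda>z. (bump R z)\<^sup>2 * energy_density z
         + 2 * (u z - k) * bump R z * (bump_x R z * p z + bump_y R z * q z))
    = - integral {- (2 * R)..2 * R} (\<lambda>x. (u (x, 0) - k) * (bump R (x, 0))\<^sup>2 * q (x, 0))"
  unfolding half_box_def
proof (rule integral_divergence_half_plane[where P = "\<lambda>z. (u z - k) * (bump R z)\<^sup>2 * p z"
      and Px = "\<lambda>z. p z * (bump R z)\<^sup>2 * p z + (u z - k) * (2 * bump R z * bump_x R z) * p z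
        + (u z - k) * (bump R z)\<^sup>2 * a z"
      and Qy = "\<lambda>z. q z * (bump R z)\<^sup>2 * q z + (u z - k) * (2 * bump R z * bump_y R z) * q z
        - (u z - k) * (bump R z)\<^sup>2 * a z"])
  note [continuous_intros] = cont cont_open continuous_on_bump[OF R]
  show "((\<lambda>x. (u (x, y) - k) * (bump R (x, y))\<^sup>2 * p (x, y)) has_real_derivative
      p (x, y) * (bump R (x, y))\<^sup>2 * p (x, y)
       + (u (x, y) - k) * (2 * bump R (x, y) * bump_x R (x, y)) * p (x, y)
       + (u (x, y) - k) * (bump R (x, y))\<^sup>2 * a (x, y)) (at x)" if "y > 0" for x y
    using that by (auto intro!: derivative_eq_intros u_x p_x bump_has_derivative_x simp: algebra_simps)
  show "((\<lambda>y. (u (x, y) - k) * (bump R (x, y))\<^sup>2 * q (x, y)) has_real_derivative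
      q (x, y) * (bump R (x, y))\<^sup>2 * q (x, y)
       + (u (x, y) - k) * (2 * bump R (x, y) * bump_y R (x, y)) * q (x, y)
       - (u (x, y) - k) * (bump R (x, y))\<^sup>2 * a (x, y)) (at y)" if "y > 0" for x y
    using that by (auto intro!: derivative_eq_intros u_y q_y bump_has_derivative_y simp: algebra_simps)
  show "continuous_on closed_half_plane (\<lambda>z. (bump R z)\<^sup>2 * energy_density z
         + 2 * (u z - k) * bump R z * (bump_x R z * p z + bump_y R z * q z))"
    by (intro continuous_intros continuous_on_energy_density)
  show "(bump R (x, y))\<^sup>2 * energy_density (x, y)
         + 2 * (u (x, y) - k) * bump R (x, y) * (bump_x R (x, y) * p (x, y) + bump_y R (x, y) * q (x, y))
      = p (x, y) * (bump R (x, y))\<^sup>2 * p (x, y)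
       + (u (x, y) - k) * (2 * bump R (x, y) * bump_x R (x, y)) * p (x, y)
       + (u (x, y) - k) * (bump R (x, y))\<^sup>2 * a (x, y)
       + (q (x, y) * (bump R (x, y))\<^sup>2 * q (x, y)
       + (u (x, y) - k) * (2 * bump R (x, y) * bump_y R (x, y)) * q (x, y)
       - (u (x, y) - k) * (bump R (x, y))\<^sup>2 * a (x, y))" for x y
    by (simp add: energy_density_def power2_eq_square algebra_simps)
qed (use R in \<open>auto simp: bump_outside
    intro!: continuous_intros cont cont_open continuous_on_bump\<close>)

text \<open>With X = (x, y), the components \<open>F1\<close>, \<open>F2\<close> below are those of
  |grad u|^2 X / 2 - (X . grad u) grad u. The function \<open>D\<close> is the x-derivative of
  \<open>F1\<close> and minus the y-derivative of \<open>F2\<close>, so only derivatives of the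
  cutoff survive; on the bottom side \<open>F2\<close> reduces to - x p q.\<close>

lemma pohozaev_identity:
  assumes R: "R > 0"
  shows "integral (half_box (2 * R))
      (\<lambda>z. bump_x R z * (fst z * ((q z)\<^sup>2 - (p z)\<^sup>2) / 2 - snd z * p z * q z)
         + bump_y R z * (snd z * ((p z)\<^sup>2 - (q z)\<^sup>2) / 2 - fst z * p z * q z))
    = integral {- (2 * R)..2 * R} (\<lambda>x. bump R (x, 0) * x * (p (x, 0) * q (x, 0)))"
proof -
  define F1 where "F1 z = fst z * ((q z)\<^sup>2 - (p z)\<^sup>2) / 2 - snd z * p z * q z" for z
  define F2 where "F2 z = snd z * ((p z)\<^sup>2 - (q z)\<^sup>2) / 2 - fst z * p z * q z" for z
  define D where "D z = ((q z)\<^sup>2 - (p z)\<^sup>2) / 2 + fst z * (q z * b z - p z * a z)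
      - snd z * (a z * q z + p z * b z)" for z
  note [continuous_intros] = cont cont_open continuous_on_bump[OF R]
  have F1_x: "((\<lambda>x. F1 (x, y)) has_real_derivative D (x, y)) (at x)" if "y > 0" for x y
    unfolding F1_def D_def using that
    by (auto intro!: derivative_eq_intros p_x q_x simp: algebra_simps)
       (simp add: field_simps)
  have F2_y: "((\<lambda>y. F2 (x, y)) has_real_derivative - D (x, y)) (at y)" if "y > 0" for x y
    unfolding F2_def D_def using that
    by (auto intro!: derivative_eq_intros p_y q_y simp: algebra_simps)
       (simp add: field_simps)
  have "integral (half_box (2 * R)) (\<lambda>z. bump_x R z * F1 z + bump_y R z * F2 z)
    = - integral {- (2 * R)..2 * R} (\<lambda>x. bump R (x, 0) * F2 (x, 0))"
    unfolding half_box_def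
  proof (rule integral_divergence_half_plane[where P = "\<lambda>z. bump R z * F1 z"
      and Px = "\<lambda>z. bump_x R z * F1 z + bump R z * D z"
      and Qy = "\<lambda>z. bump_y R z * F2 z - bump R z * D z"])
    show "((\<lambda>x. bump R (x, y) * F1 (x, y)) has_real_derivative
        bump_x R (x, y) * F1 (x, y) + bump R (x, y) * D (x, y)) (at x)" if "y > 0" for x y
      using that by (auto intro!: derivative_eq_intros F1_x bump_has_derivative_x)
    show "((\<lambda>y. bump R (x, y) * F2 (x, y)) has_real_derivative
        bump_y R (x, y) * F2 (x, y) - bump R (x, y) * D (x, y)) (at y)" if "y > 0" for x y
      using that by (auto intro!: derivative_eq_intros F2_y bump_has_derivative_y)
    show "continuous_on half_plane (\<lambda>z. bump_y R z * F2 z - bump R z * D z)"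
      unfolding F2_def D_def by (intro continuous_intros) auto
  qed (use R in \<open>auto simp: bump_outside F1_def F2_def
      intro!: continuous_intros cont cont_open continuous_on_bump\<close>)
  then show ?thesis
    by (simp add: F1_def F2_def mult.assoc)
qed

text \<open>On \<open>half_box (2 * R)\<close> each field component is at most 2 R |grad u|^2 and
  each cutoff derivative at most 16 / R. The two products give 32 + 32, and the cutoff derivatives
  vanish on \<open>half_box R\<close>.\<close>

lemma pohozaev_estimate:
  assumes R: "R > 0"
  shows "\<bar>integral {- (2 * R)..2 * R} (\<lambda>x. bump R (x, 0) * x * (p (x, 0) * q (x, 0)))\<bar>
    \<le> 64 * (energy (2 * R) - energy R)"
proof -
  define h where "h z = bump_x R z * (fst z * ((q z)\<^sup>2 - (p z)\<^sup>2) / 2 - snd z * p z * q z)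
         + bump_y R z * (snd z * ((p z)\<^sup>2 - (q z)\<^sup>2) / 2 - fst z * p z * q z)" for z
  have h_cont: "continuous_on closed_half_plane h"
    unfolding h_def by (intro continuous_intros cont continuous_on_bump[OF R]) auto
  have pq: "\<bar>x * (s\<^sup>2 - t\<^sup>2) / 2 - y * t * s\<bar> \<le> 2 * R * (t\<^sup>2 + s\<^sup>2)" 
    if "\<bar>x\<bar> \<le> 2 * R" "\<bar>y\<bar> \<le> 2 * R" for x y s t :: real
  proof -
    have 1: "\<bar>s\<^sup>2 - t\<^sup>2\<bar> \<le> t\<^sup>2 + s\<^sup>2" 
      by (simp add: abs_le_iff)
    have 2: "2 * \<bar>t * s\<bar> \<le> t\<^sup>2 + s\<^sup>2"
      using sum_squares_bound[of t s] sum_squares_bound[of t "- s"] by (simp add: abs_if)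
    have "\<bar>x * (s\<^sup>2 - t\<^sup>2) / 2 - y * t * s\<bar> \<le> \<bar>x\<bar> * \<bar>s\<^sup>2 - t\<^sup>2\<bar> / 2 + \<bar>y\<bar> * \<bar>t * s\<bar>"
      by (rule order_trans[OF abs_triangle_ineq4]) (simp add: abs_mult mult.assoc)
    also have "\<dots> \<le> (2 * R) * (t\<^sup>2 + s\<^sup>2) / 2 + (2 * R) * ((t\<^sup>2 + s\<^sup>2) / 2)"
      by (intro add_mono divide_right_mono mult_mono) (use that 1 2 in auto)
    finally show ?thesis by (simp add: algebra_simps)
  qed
  have bound: "\<bar>h z\<bar> \<le> 64 * energy_density z" if "z \<in> half_box (2 * R)" for z
  proof -
    obtain x y where z: "z = (x, y)" by (cases z)
    have xy: "\<bar>x\<bar> \<le> 2 * R" "\<bar>y\<bar> \<le> 2 * R" using that by (auto simp: z mem_half_box)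
    \<comment> \<open>The second component is the first with x, y and \<open>p\<close>,
      \<open>q\<close> interchanged, so \<open>pq\<close> bounds both.\<close>
    have "\<bar>h z\<bar> \<le> \<bar>bump_x R z\<bar> * \<bar>x * ((q z)\<^sup>2 - (p z)\<^sup>2) / 2 - y * p z * q z\<bar>
       + \<bar>bump_y R z\<bar> * \<bar>y * ((p z)\<^sup>2 - (q z)\<^sup>2) / 2 - x * q z * p z\<bar>"
      unfolding h_def by (rule order_trans[OF abs_triangle_ineq]) (simp add: abs_mult z mult_ac)
    also have "\<dots> \<le> 16 / R * (2 * R * ((p z)\<^sup>2 + (q z)\<^sup>2)) + 16 / R * (2 * R * ((q z)\<^sup>2 + (p z)\<^sup>2))"
      by (intro add_mono mult_mono bump_deriv_bound pq xy R) (use R in auto)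
    also have "\<dots> = 64 * energy_density z"
      using R by (simp add: energy_density_def field_simps)
    finally show ?thesis .
  qed
  have "\<bar>integral (half_box (2 * R)) h\<bar> \<le>
      integral (half_box (2 * R)) (\<lambda>z. 64 * energy_density z) - integral (half_box R) (\<lambda>z. 64 * energy_density z)"
    by (rule abs_integral_le_tail)
      (use R bound in \<open>auto intro!: half_box_mono integrable_half_box h_cont continuous_intros 
        continuous_on_energy_density simp: h_def bump_deriv_eq_0\<close>)
  then show ?thesis
    unfolding h_def pohozaev_identity[OF R] by (simp add: energy_def algebra_simps)
qed

end

section \<open>Energy bounds and limits along dyadic scales\<close>

lemma incseq_bounded_increments_tendsto_0:
  fixes a :: "nat \<Rightarrow> real"
  assumes "incseq a" "\<And>n. a n \<le> M"
  shows "(\<lambda>n. a (Suc n) - a n) \<longlonglongrightarrow> 0"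
proof -
  obtain L where L: "a \<longlonglongrightarrow> L" 
    using incseq_convergent[OF assms(1)] assms(2) by blast
  from tendsto_diff[OF LIMSEQ_Suc[OF L] L] show ?thesis by simp
qed

context half_plane_harmonic
begin

lemma continuous_on_boundary:
  "continuous_on S (\<lambda>x. u (x, 0))" "continuous_on S (\<lambda>x. p (x, 0))" "continuous_on S (\<lambda>x. q (x, 0))"
  by (rule continuous_on_compose2[OF cont(1)] continuous_on_compose2[OF cont(2)] 
      continuous_on_compose2[OF cont(3)]; auto intro!: continuous_intros simp: closed_half_plane_def)+

lemma continuous_on_bump_boundary:
  assumes "R > 0"
  shows "continuous_on S (\<lambda>x. bump R (x, 0))" "continuous_on S (\<lambda>x. bump_x R (x, 0))"
  by (rule continuous_on_compose2[OF continuous_on_bump(1)[OF assms, of UNIV]]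
      continuous_on_compose2[OF continuous_on_bump(2)[OF assms, of UNIV]]; 
      auto intro!: continuous_intros)+

text \<open>Young's inequality absorbs half of the weighted energy \<open>e\<close> +
  \<open>e\<close> in the Caccioppoli identity. With |u - k| \<le> 2 and cutoff derivatives at most
  16 / R, each component costs 2 (32 / R)^2 = 2048 / R^2. Both together, times the area 8 R^2, give
  32768, which is doubled at the end.\<close>

lemma energy_estimate:
  assumes R: "R > 0" and bd: "\<And>z. z \<in> closed_half_plane \<Longrightarrow> \<bar>u z - k\<bar> \<le> 2"
  shows "energy R \<le> 65536
    - 2 * integral {- (2 * R)..2 * R} (\<lambda>x. (u (x, 0) - k) * (bump R (x, 0))\<^sup>2 * q (x, 0))"
proof -
  define h where "h z = (bump R z)\<^sup>2 * energy_density z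
         + 2 * (u z - k) * bump R z * (bump_x R z * p z + bump_y R z * q z)" for z
  define e where "e z = (bump R z)\<^sup>2 * energy_density z / 2" for z
  note [continuous_intros] = cont continuous_on_bump[OF R] continuous_on_energy_density
  have e_int: "e integrable_on half_box S" for S
    unfolding e_def by (intro integrable_half_box continuous_intros) auto
  have h_int: "h integrable_on half_box S" for S
    unfolding h_def by (intro integrable_half_box continuous_intros)
  have pw: "e z - 4096 / R\<^sup>2 \<le> h z" if "z \<in> half_box (2 * R)" for z
  proof -
    have y: "2 * v * s * t \<ge> - (t\<^sup>2 / 2) - 2048 / R\<^sup>2" if "\<bar>v\<bar> \<le> 2" "\<bar>s\<bar> \<le> 16 / R" for v s t :: real
    proof -
      have "\<bar>v * s\<bar> \<le> 2 * (16 / R)"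
        unfolding abs_mult using that by (intro mult_mono) auto
      then have "(v * s)\<^sup>2 \<le> (2 * (16 / R))\<^sup>2"
        using R by (simp add: abs_le_square_iff[symmetric])
      then have "2 * (v * s)\<^sup>2 \<le> 2048 / R\<^sup>2"
        by (simp add: power_mult_distrib power_divide)
      moreover have "0 \<le> (2 * (v * s) + t)\<^sup>2 / 2" by simp
      then have "0 \<le> 2 * (v * s)\<^sup>2 + 2 * v * s * t + t\<^sup>2 / 2"
        by (simp add: power2_eq_square algebra_simps)
      ultimately show ?thesis by linarith
    qed
    have v: "\<bar>u z - k\<bar> \<le> 2" using bd that half_box_subset by blast
    have "h z = 2 * e z + 2 * (u z - k) * bump_x R z * (bump R z * p z)
        + 2 * (u z - k) * bump_y R z * (bump R z * q z)"
      by (simp add: h_def e_def algebra_simps)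
    moreover have "(bump R z * p z)\<^sup>2 / 2 + (bump R z * q z)\<^sup>2 / 2 = e z"
      by (simp add: e_def energy_density_def power_mult_distrib field_simps)
    ultimately show ?thesis
      using y[OF v bump_deriv_bound(1)[OF R, of z], of "bump R z * p z"]
        y[OF v bump_deriv_bound(2)[OF R, of z], of "bump R z * q z"] by simp
  qed
  have "energy R / 2 = integral (half_box R) e"
    unfolding energy_def integral_divide[symmetric]
    by (rule integral_cong) (simp add: e_def bump_eq_1 R)
  also have "\<dots> \<le> integral (half_box (2 * R)) e"
    using R by (intro integral_subset_le half_box_mono e_int) (auto simp: e_def energy_density_nonneg)
  also have "\<dots> = integral (half_box (2 * R)) (\<lambda>z. e z - 4096 / R\<^sup>2) + 32768"
    using R by (subst integral_diff)
      (auto simp: e_int integral_const_half_box intro!: integrable_half_box continuous_intros)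
  also have "integral (half_box (2 * R)) (\<lambda>z. e z - 4096 / R\<^sup>2) \<le> integral (half_box (2 * R)) h"
    by (intro integral_le pw h_int integrable_diff e_int integrable_half_box continuous_intros)
  also have "\<dots> = - integral {- (2 * R)..2 * R} (\<lambda>x. (u (x, 0) - k) * (bump R (x, 0))\<^sup>2 * q (x, 0))"
    unfolding h_def by (rule caccioppoli_identity[OF R])
  finally show ?thesis by simp
qed

text \<open>With u = k on the boundary the Caccioppoli identity has no boundary term, and the cross
  term lives outside \<open>half_box R\<close>. Young's inequality with the free parameter
  \<open>l\<close> splits it into 2 l / R^2, whose integral over the region of area 6 R^2 is 12 l,
  and a multiple of the energy there. Keeping \<open>l\<close> fixed while R grows makes the second
  part disappear once the energy is bounded.\<close>

lemma energy_le_tail: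
  assumes R: "R > 0" and bd: "\<And>z. z \<in> closed_half_plane \<Longrightarrow> \<bar>u z - k\<bar> \<le> 2"
    and boundary: "\<And>x. u (x, 0) = k" and l: "l > 0"
  shows "energy R \<le> 12 * l + 1024 / l * (energy (2 * R) - energy R)"
proof -
  define h where "h z = 2 * (u z - k) * bump R z * (bump_x R z * p z + bump_y R z * q z)" for z
  define g where "g z = 2 * l / R\<^sup>2 + 1024 / l * energy_density z" for z
  note [continuous_intros] = cont continuous_on_bump[OF R] continuous_on_energy_density
  have e_int: "(\<lambda>z. (bump R z)\<^sup>2 * energy_density z) integrable_on half_box S" for S
    by (intro integrable_half_box continuous_intros)
  have h_int: "h integrable_on half_box S" for S
    unfolding h_def by (intro integrable_half_box continuous_intros)
  have g_int: "g integrable_on half_box S" for S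
    unfolding g_def by (intro integrable_half_box continuous_intros)
  have pw: "\<bar>h z\<bar> \<le> g z" if "z \<in> half_box (2 * R)" for z
  proof -
    have v: "\<bar>u z - k\<bar> \<le> 2" using bd that half_box_subset by blast
    have am: "64 / R * \<bar>t\<bar> \<le> l / R\<^sup>2 + 1024 / l * t\<^sup>2" for t
    proof -
      have "0 \<le> (l / R - 32 * \<bar>t\<bar>)\<^sup>2 / l" using l by simp
      also have "\<dots> = l / R\<^sup>2 - 64 / R * \<bar>t\<bar> + 1024 / l * t\<^sup>2"
        using l R by (simp add: power2_eq_square field_simps)
      finally show ?thesis by simp
    qed
    have "\<bar>h z\<bar> = 2 * \<bar>u z - k\<bar> * bump R z * \<bar>bump_x R z * p z + bump_y R z * q z\<bar>"
      unfolding h_def by (simp only: abs_mult abs_of_nonneg[OF bump_nonneg] abs_numeral)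
    also have "\<dots> \<le> 2 * 2 * 1 * (16 / R * \<bar>p z\<bar> + 16 / R * \<bar>q z\<bar>)"
    proof (intro mult_mono bump_le_1 v order_trans[OF abs_triangle_ineq] add_mono)
      show "\<bar>bump_x R z * p z\<bar> \<le> 16 / R * \<bar>p z\<bar>" "\<bar>bump_y R z * q z\<bar> \<le> 16 / R * \<bar>q z\<bar>"
        using bump_deriv_bound[OF R, of z] by (simp_all only: abs_mult mult_right_mono abs_ge_zero)
    qed (auto simp: bump_nonneg)
    also have "\<dots> = 64 / R * \<bar>p z\<bar> + 64 / R * \<bar>q z\<bar>" by (simp add: algebra_simps)
    also have "\<dots> \<le> (l / R\<^sup>2 + 1024 / l * (p z)\<^sup>2) + (l / R\<^sup>2 + 1024 / l * (q z)\<^sup>2)"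
      by (intro add_mono am)
    also have "\<dots> = g z"
      by (simp add: g_def energy_density_def distrib_left)
    finally show ?thesis .
  qed
  have id: "integral (half_box (2 * R)) (\<lambda>z. (bump R z)\<^sup>2 * energy_density z + h z) = 0"
    using caccioppoli_identity[OF R, of k] by (simp add: h_def boundary)
  have "energy R = integral (half_box R) (\<lambda>z. (bump R z)\<^sup>2 * energy_density z)"
    unfolding energy_def by (rule integral_cong) (simp add: bump_eq_1 R)
  also have "\<dots> \<le> integral (half_box (2 * R)) (\<lambda>z. (bump R z)\<^sup>2 * energy_density z)"
    using R by (intro integral_subset_le half_box_mono e_int) (auto simp: energy_density_nonneg)
  also have "\<dots> \<le> \<bar>integral (half_box (2 * R)) h\<bar>"
    using id by (simp add: integral_add e_int h_int)
  also have "\<dots> \<le> integral (half_box (2 * R)) g - integral (half_box R) g"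
  proof (rule abs_integral_le_tail)
    show "h z = 0" if "z \<in> half_box R" for z
      using that R by (simp add: h_def bump_deriv_eq_0)
  qed (use R pw in \<open>auto intro!: half_box_mono h_int g_int\<close>)
  also have "\<dots> = 12 * l + 1024 / l * (energy (2 * R) - energy R)"
  proof -
    have "integral (half_box S) g = 2 * S\<^sup>2 * (2 * l / R\<^sup>2) + 1024 / l * energy S" if "S \<ge> 0" for S
      using that l unfolding g_def[abs_def] energy_def
      by (subst integral_add) (auto simp: integral_const_half_box
          intro!: integrable_half_box continuous_intros)
    from this[of R] this[of "2 * R"] show ?thesis
      using R by (simp add: right_diff_distrib)
  qed
  finally show ?thesis .
qed

lemma incseq_energy: "r > 0 \<Longrightarrow> incseq (\<lambda>n. energy (r * 2 ^ n))"
  by (intro monoI energy_mono mult_left_mono) auto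

text \<open>Bounded energy has increments tending to 0 along dyadic radii, so
  \<open>energy_le_tail\<close> leaves at most 12 l for every l > 0. The gradient therefore
  vanishes, and \<open>u\<close> is constant on vertical lines down to the boundary.\<close>

lemma eq_boundary_value_if_energy_bounded:
  assumes bd: "\<And>z. z \<in> closed_half_plane \<Longrightarrow> \<bar>u z - k\<bar> \<le> 2"
    and boundary: "\<And>x. u (x, 0) = k" and r: "r > 0" and M: "\<And>n. energy (r * 2 ^ n) \<le> M"
    and z: "z \<in> closed_half_plane"
  shows "u z = k"
proof -
  have le: "energy R \<le> 0" if "R > 0" for R
  proof (rule field_le_epsilon)
    fix \<epsilon> :: real assume "\<epsilon> > 0"
    define l where "l = \<epsilon> / 12"
    have l: "l > 0" using \<open>\<epsilon> > 0\<close> by (simp add: l_def)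
    have "(\<lambda>n. energy (R * 2 ^ Suc n) - energy (R * 2 ^ n)) \<longlonglongrightarrow> 0"
    proof (rule incseq_bounded_increments_tendsto_0[OF incseq_energy[OF \<open>R > 0\<close>]])
      fix n
      \<comment> \<open>The bound \<open>M\<close> is given along the radii r 2^n only; monotonicity
        carries it over to R 2^n.\<close>
      obtain m where m: "R * 2 ^ n / r < 2 ^ m" using real_arch_pow[of 2] by auto
      have "energy (R * 2 ^ n) \<le> energy (r * 2 ^ m)"
        using m r by (intro energy_mono) (simp add: field_simps)
      also have "\<dots> \<le> M" by (rule M)
      finally show "energy (R * 2 ^ n) \<le> M" .
    qed
    then have "(\<lambda>n. 12 * l + 1024 / l * (energy (R * 2 ^ Suc n) - energy (R * 2 ^ n))) 
        \<longlonglongrightarrow> 12 * l + 1024 / l * 0"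
      by (intro tendsto_intros)
    moreover have "energy R \<le> 12 * l + 1024 / l * (energy (R * 2 ^ Suc n) - energy (R * 2 ^ n))" for n
    proof -
      have "energy R \<le> energy (R * 2 ^ n)"
        using \<open>R > 0\<close> by (intro energy_mono) simp
      also have "\<dots> \<le> 12 * l + 1024 / l * (energy (2 * (R * 2 ^ n)) - energy (R * 2 ^ n))"
        using \<open>R > 0\<close> by (intro energy_le_tail[OF _ bd boundary l]) auto
      finally show ?thesis by (simp add: mult_ac)
    qed
    ultimately have "energy R \<le> 12 * l + 1024 / l * 0"
      by (intro LIMSEQ_le_const) auto
    then show "energy R \<le> 0 + \<epsilon>" by (simp add: l_def)
  qed
  have zero: "energy_density z = 0" if "z \<in> half_plane" for z
  proof -
    obtain x y where "z = (x, y)" by (cases z)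
    with that have z: "z = (x, y)" "y > 0" by (auto simp: half_plane_def)
    define R where "R = \<bar>x\<bar> + y"
    have R: "R > 0" "z \<in> half_box R" using z by (auto simp: R_def mem_half_box)
    have c: "continuous_on (half_box R) energy_density"
      using continuous_on_energy_density half_box_subset by (rule continuous_on_subset)
    have "integral (half_box R) energy_density = 0"
      using le[OF R(1)] energy_density_nonneg by (intro antisym integral_nonneg) 
        (auto simp: energy_def integrable_half_box continuous_on_energy_density)
    \<comment> \<open>An interior point certifies that the box is nondegenerate, so a continuous
      nonnegative density with integral 0 vanishes on it.\<close>
    moreover have "(0, R / 2) \<in> box (- R, 0) (R, R)" using R by (auto simp: box_def Basis_prod_def)
    ultimately show ?thesis
      using integral_cbox_eq_0_iff[of "(- R, 0)" "(R, R)" energy_density] c R energy_density_nonneg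
      unfolding half_box_def by blast
  qed
  obtain x y where "z = (x, y)" by (cases z)
  with z have xy: "z = (x, y)" "y \<ge> 0" by (auto simp: closed_half_plane_def)
  show ?thesis
  proof (cases "y = 0")
    case False
    have "u (x, y) = u (x, 0)"
    proof (rule DERIV_isconst_end[where f = "\<lambda>t. u (x, t)"])
      show "continuous_on {0..y} (\<lambda>y. u (x, y))"
        by (rule continuous_on_compose2[OF cont(1)]) 
          (auto intro!: continuous_intros simp: closed_half_plane_def)
      show "((\<lambda>y. u (x, y)) has_real_derivative 0) (at t)" if "0 < t" "t < y" for t
        using u_y[OF that(1), of x] zero[of "(x, t)"] that 
        by (auto simp: half_plane_def energy_density_def sum_power2_eq_zero_iff)
    qed (use xy False in auto)
    then show ?thesis by (simp add: xy boundary)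
  qed (simp add: xy boundary)
qed

text \<open>The function \<open>w\<close> stands for G(u(x, 0)), whose derivative is p q because u_y
  = G'(u) on the boundary. The energy estimate bounds the energy and the integral \<open>W\<close>
  of \<open>w\<close>; the Pohozaev estimate then bounds \<open>W\<close> by increments of both,
  which tend to 0 along dyadic radii.\<close>

lemma boundary_potential_vanishes:
  assumes bd: "\<And>z. z \<in> closed_half_plane \<Longrightarrow> \<bar>u z - k\<bar> \<le> 2"
    and w: "\<And>x. (w has_real_derivative p (x, 0) * q (x, 0)) (at x)"
    and w_nonneg: "\<And>x. 0 \<le> w x"
    and r: "r > 0" and w_le: "\<And>x. \<bar>x\<bar> \<ge> r \<Longrightarrow> w x \<le> (u (x, 0) - k) * q (x, 0)"
  shows "w x = 0" and "\<exists>M. \<forall>n. energy (r * 2 ^ n) \<le> M"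
proof -
  have w_cont: "continuous_on S w" for S
    using w by (intro continuous_at_imp_continuous_on) (auto intro: DERIV_isCont)
  note [continuous_intros] = continuous_on_boundary w_cont continuous_on_bump_boundary
  define W where "W R = integral {- R..R} w" for R
  define h where "h x = (u (x, 0) - k) * q (x, 0) - w x" for x
  have h_cont: "continuous_on S h" for S unfolding h_def by (intro continuous_intros)
  have w_int: "w integrable_on {s..t}" for s t
    by (intro integrable_continuous_real continuous_intros)
  have W_mono: "W R \<le> W S" if "R \<le> S" for R S
    unfolding W_def using that w_nonneg by (intro integral_subset_le w_int) auto
  obtain M where "\<forall>x\<in>{- r..r}. \<bar>h x\<bar> \<le> M"
    using compact_imp_bounded[OF compact_continuous_image[OF h_cont compact_Icc, of "- r" r]]
    by (auto simp: bounded_iff)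
  then have M: "\<bar>h x\<bar> \<le> M" if "x \<in> {- r..r}" for x
    using that by blast
  have "M \<ge> 0" using M[of 0] r by auto
  \<comment> \<open>The defect \<open>h\<close> is nonnegative outside [-r, r] and at least - M
    inside, so replacing (u - k) q by \<open>w\<close> under the weight costs at most 2 r M. The
    energy estimate doubles this.\<close>
  have main: "energy R + 2 * W R \<le> 65536 + 4 * r * M" if R: "R \<ge> r" for R
  proof -
    have R0: "R > 0" using r R by simp
    let ?I = "{- (2 * R)..2 * R}"
    let ?b = "\<lambda>x. (bump R (x, 0))\<^sup>2"
    have sub: "{- r..r} \<inter> ?I = {- r..r}" using R R0 by auto
    have "- (2 * r * M) = integral ?I (\<lambda>x. if x \<in> {- r..r} then - M else 0)"
      using r by (simp only: integral_restrict_Int sub) simp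
    also have "\<dots> \<le> integral ?I (\<lambda>x. ?b x * h x)"
    proof (rule integral_le)
      show "(\<lambda>x. if x \<in> {- r..r} then - M else 0) integrable_on ?I"
        using integrable_restrict_Int[of "{- r..r}" "\<lambda>_. - M" ?I] sub by auto
      show "(\<lambda>x. ?b x * h x) integrable_on ?I"
        by (intro integrable_continuous_real continuous_intros h_cont R0)
      show "(if x \<in> {- r..r} then - M else 0) \<le> ?b x * h x" if "x \<in> ?I" for x
      proof (cases "x \<in> {- r..r}")
        case True
        have "\<bar>?b x * h x\<bar> \<le> 1 * M"
          unfolding abs_mult using bump_nonneg bump_le_1 M[OF True] 
          by (intro mult_mono) (auto intro: power_le_one)
        with True show ?thesis by auto
      next
        case False
        then have "h x \<ge> 0" using w_le[of x] by (auto simp: h_def)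
        with False show ?thesis by auto
      qed
    qed
    also have "\<dots> = integral ?I (\<lambda>x. (u (x, 0) - k) * ?b x * q (x, 0)) - integral ?I (\<lambda>x. ?b x * w x)"
      by (subst integral_diff[symmetric]) 
        (auto intro!: integrable_continuous_real continuous_intros R0 simp: h_def algebra_simps)
    finally have 1: "integral ?I (\<lambda>x. ?b x * w x) \<le> 2 * r * M + integral ?I (\<lambda>x. (u (x, 0) - k) * ?b x * q (x, 0))"
      by simp
    have "W R = integral {- R..R} (\<lambda>x. ?b x * w x)"
      unfolding W_def using R0 by (intro integral_cong) (auto simp: bump_eq_1 mem_half_box)
    also have "\<dots> \<le> integral ?I (\<lambda>x. ?b x * w x)"
      using R0 w_nonneg by (intro integral_subset_le) 
       (auto intro!: integrable_continuous_real continuous_intros)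
    finally show ?thesis using 1 energy_estimate[OF R0 bd] by simp
  qed
  have poho: "W R \<le> 32 * (W (2 * R) - W R) + 64 * (energy (2 * R) - energy R)" if R: "R > 0" for R
  proof -
    let ?I = "{- (2 * R)..2 * R}"
    let ?A = "\<lambda>x. bump R (x, 0) * w x" and ?B = "\<lambda>x. x * bump_x R (x, 0) * w x"
      and ?C = "\<lambda>x. bump R (x, 0) * x * (p (x, 0) * q (x, 0))"
    have int: "?A integrable_on ?I" "?B integrable_on ?I" "?C integrable_on ?I" "?A integrable_on {-R..R}"
      by (intro integrable_continuous_real continuous_intros R)+
    \<comment> \<open>Integration by parts: the integrand is the derivative of x bump w, which
      vanishes at both ends. Thus \<open>?A\<close>, whose integral dominates \<open>W R\<close>, is
      controlled by the Pohozaev term \<open>?C\<close> and by \<open>?B\<close>, which is 0 on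
      [-R, R] and at most 2 R (16 / R) w beyond.\<close>
    have "((\<lambda>x. ?A x + ?B x + ?C x) has_integral 
        (2 * R * bump R (2 * R, 0) * w (2 * R) - (- (2 * R)) * bump R (- (2 * R), 0) * w (- (2 * R)))) ?I"
    proof (rule fundamental_theorem_of_calculus[where f = "\<lambda>x. x * bump R (x, 0) * w x"])
      fix x assume "x \<in> ?I"
      have "((\<lambda>x. x * bump R (x, 0) * w x) has_real_derivative ?A x + ?B x + ?C x) (at x)"
        by (auto intro!: derivative_eq_intros bump_has_derivative_x w simp: algebra_simps)
      then show "((\<lambda>x. x * bump R (x, 0) * w x) has_vector_derivative ?A x + ?B x + ?C x) (at x within ?I)"
        unfolding has_real_derivative_iff_has_vector_derivative[symmetric]
        by (rule has_field_derivative_at_within)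
    qed (use R in auto)
    then have "integral ?I (\<lambda>x. ?A x + ?B x + ?C x) = 0"
      using bump_outside[OF R] by (simp add: integral_unique)
    then have "integral ?I ?A + integral ?I ?B + integral ?I ?C = 0"
      using int by (simp add: integral_add integrable_add)
    moreover have "\<bar>integral ?I ?C\<bar> \<le> 64 * (energy (2 * R) - energy R)"
      by (rule pohozaev_estimate[OF R])
    moreover have "\<bar>integral ?I ?B\<bar> \<le> integral ?I (\<lambda>x. 32 * w x) - integral {- R..R} (\<lambda>x. 32 * w x)"
    proof (rule abs_integral_le_tail)
      show "\<bar>?B x\<bar> \<le> 32 * w x" if "x \<in> ?I - {- R..R}" for x
      proof -
        have "\<bar>x\<bar> * \<bar>bump_x R (x, 0)\<bar> \<le> 2 * R * (16 / R)"
          using that R by (intro mult_mono bump_deriv_bound) auto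
        then show ?thesis using R w_nonneg[of x] by (auto simp: abs_mult intro: mult_right_mono)
      qed
      show "?B x = 0" if "x \<in> {- R..R}" for x
        using that R bump_deriv_eq_0[of "(x, 0)" R] by (auto simp: mem_half_box)
    qed (use R in \<open>auto intro!: int(2) integrable_continuous_real continuous_intros\<close>)
    then have "\<bar>integral ?I ?B\<bar> \<le> 32 * (W (2 * R) - W R)"
      by (simp add: W_def algebra_simps)
    moreover have "W R = integral {- R..R} ?A"
      unfolding W_def using R by (intro integral_cong) (auto simp: bump_eq_1 mem_half_box)
    then have "W R \<le> integral ?I ?A"
      using R w_nonneg int by (simp, intro integral_subset_le) (auto simp: bump_nonneg)
    ultimately show ?thesis by linarith
  qed
  have rn: "r * 2 ^ n \<ge> r" for n using r by simp
  have nonneg: "energy R \<ge> 0" "W R \<ge> 0" for R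
    using energy_density_nonneg w_nonneg w_int
    by (auto simp: energy_def W_def intro!: integral_nonneg integrable_half_box continuous_on_energy_density)
  have E_bd: "energy (r * 2 ^ n) \<le> 65536 + 4 * r * M" for n
    using main[OF rn, of n] nonneg(2)[of "r * 2 ^ n"] by simp
  then show "\<exists>M. \<forall>n. energy (r * 2 ^ n) \<le> M" by blast
  have W_bd: "W (r * 2 ^ n) \<le> 65536 + 4 * r * M" for n
    using main[OF rn, of n] nonneg[of "r * 2 ^ n"] by simp
  have "incseq (\<lambda>n. W (r * 2 ^ n))"
    using r by (intro monoI W_mono mult_left_mono) auto
  note lims = incseq_bounded_increments_tendsto_0[OF this W_bd]
    incseq_bounded_increments_tendsto_0[OF incseq_energy[OF r] E_bd]
  have lim: "(\<lambda>n. 32 * (W (r * 2 ^ Suc n) - W (r * 2 ^ n))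
      + 64 * (energy (r * 2 ^ Suc n) - energy (r * 2 ^ n))) \<longlonglongrightarrow> 32 * 0 + 64 * 0"
    by (intro tendsto_intros lims)
  \<comment> \<open>The radius r 2^m is chosen to capture \<open>x\<close>. By monotonicity,
    \<open>W\<close> there is below every later bound of \<open>poho\<close>, and these bounds tend
    to 0.\<close>
  obtain m where m: "\<bar>x\<bar> / r < 2 ^ m" using real_arch_pow[of 2] by auto
  have "W (r * 2 ^ m) \<le> 32 * 0 + 64 * 0"
  proof (rule LIMSEQ_le_const[OF lim], intro exI allI impI)
    fix n assume "m \<le> n"
    then have "W (r * 2 ^ m) \<le> W (r * 2 ^ n)"
      using r by (intro W_mono mult_left_mono power_increasing) auto
    also have "\<dots> \<le> 32 * (W (r * 2 ^ Suc n) - W (r * 2 ^ n))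
      + 64 * (energy (r * 2 ^ Suc n) - energy (r * 2 ^ n))"
      using poho[of "r * 2 ^ n"] r by (simp add: mult_ac)
    finally show "W (r * 2 ^ m) \<le> 32 * (W (r * 2 ^ Suc n) - W (r * 2 ^ n))
      + 64 * (energy (r * 2 ^ Suc n) - energy (r * 2 ^ n))" .
  qed
  then have "integral {- (r * 2 ^ m)..r * 2 ^ m} w = 0"
    using nonneg(2)[of "r * 2 ^ m"] by (simp add: W_def)
  then have "\<forall>x\<in>{- (r * 2 ^ m)..r * 2 ^ m}. w x = 0"
    using r w_nonneg by (subst (asm) integral_eq_0_iff) (auto intro: w_cont)
  moreover have "\<bar>x\<bar> < r * 2 ^ m" using m r by (simp add: field_simps)
  then have "x \<in> {- (r * 2 ^ m)..r * 2 ^ m}" by (simp add: abs_less_iff)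
  ultimately show "w x = 0" by blast
qed

end

section \<open>From classical solutions to the harmonic setting\<close>

lemma partial_derivative_x:
  assumes "g differentiable (at (x, y) within S)" "\<And>t. (t, y) \<in> S"
  shows "((\<lambda>t. g (t, y)) has_real_derivative dir_deriv S (1, 0) g (x, y)) (at x)"
proof -
  let ?D = "frechet_derivative g (at (x, y) within S)"
  have D: "(g has_derivative ?D) (at (x, y) within S)"
    using assms(1) by (simp add: frechet_derivative_works)
  have "((\<lambda>t. g (t, y)) has_derivative (\<lambda>t. ?D (t, 0))) (at x)"
  proof (rule has_derivative_in_compose[where f = "\<lambda>t. (t, y)" and g = g])
    show "((\<lambda>t. (t, y)) has_derivative (\<lambda>t. (t, 0))) (at x)"
      by (auto intro!: derivative_eq_intros)
    show "(g has_derivative ?D) (at (x, y) within range (\<lambda>t. (t, y)))"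
      using assms(2) by (intro has_derivative_subset[OF D]) auto
  qed
  moreover have "(\<lambda>t. ?D (t, 0)) = (*) (?D (1, 0))"
  proof
    show "?D (t, 0) = ?D (1, 0) * t" for t
      using linear_cmul[OF has_derivative_linear[OF D], of t "(1, 0)"] by simp
  qed
  ultimately show ?thesis
    by (simp add: has_field_derivative_def dir_deriv_def)
qed

lemma partial_derivative_y:
  assumes "g differentiable (at (x, y) within S)" "\<And>t. t > 0 \<Longrightarrow> (x, t) \<in> S" "y > 0"
  shows "((\<lambda>t. g (x, t)) has_real_derivative dir_deriv S (0, 1) g (x, y)) (at y)"
proof -
  let ?D = "frechet_derivative g (at (x, y) within S)"
  have D: "(g has_derivative ?D) (at (x, y) within S)"
    using assms(1) by (simp add: frechet_derivative_works)
  \<comment> \<open>Restricting to the open ray serves both the open and the closed half-plane, and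
    openness turns the result into a two-sided derivative.\<close>
  have "((\<lambda>t. g (x, t)) has_derivative (\<lambda>t. ?D (0, t))) (at y within {0<..})"
  proof (rule has_derivative_in_compose[where f = "\<lambda>t. (x, t)" and g = g])
    show "((\<lambda>t. (x, t)) has_derivative (\<lambda>t. (0, t))) (at y within {0<..})"
      by (auto intro!: derivative_eq_intros)
    show "(g has_derivative ?D) (at (x, y) within (\<lambda>t. (x, t)) ` {0<..})"
      using assms(2) by (intro has_derivative_subset[OF D]) auto
  qed
  moreover have "(\<lambda>t. ?D (0, t)) = (*) (?D (0, 1))"
  proof
    show "?D (0, t) = ?D (0, 1) * t" for t
      using linear_cmul[OF has_derivative_linear[OF D], of t "(0, 1)"] by simp
  qed
  ultimately show ?thesis
    using assms(3) at_within_open[of y "{0<..}"] by (simp add: has_field_derivative_def dir_deriv_def)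
qed

text \<open>Derivatives within the closed half-plane (\<open>p\<close>, \<open>q\<close>) carry
  continuity up to the boundary, while those within the open one (\<open>p'\<close>,
  \<open>q'\<close>) carry the second-order regularity. They agree for y > 0 by uniqueness of
  derivatives along lines, so both kinds of information can be combined.\<close>

lemma half_plane_harmonic_solution:
  assumes sol: "boundary_reaction_solution f u"
  shows "\<exists>a b. half_plane_harmonic u (dir_deriv closed_half_plane (1, 0) u)
    (dir_deriv closed_half_plane (0, 1) u) a b"
proof -
  define p where "p = dir_deriv closed_half_plane (1, 0) u"
  define q where "q = dir_deriv closed_half_plane (0, 1) u"
  define p' where "p' = dir_deriv half_plane (1, 0) u"
  define q' where "q' = dir_deriv half_plane (0, 1) u"
  define a where "a = dir_deriv half_plane (1, 0) p'"
  define b where "b = dir_deriv half_plane (0, 1) p'"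
  define c where "c = dir_deriv half_plane (1, 0) q'"
  have C1: "C1_on closed_half_plane u" and C2: "C2_on half_plane u"
    using sol by (auto simp: boundary_reaction_solution_def)
  have basis: "(1, 0) \<in> (Basis :: (real \<times> real) set)" "(0, 1) \<in> (Basis :: (real \<times> real) set)"
    by (auto simp: Basis_prod_def)
  have cont: "continuous_on closed_half_plane u" "continuous_on closed_half_plane p" "continuous_on closed_half_plane q"
    using C1 basis by (auto simp: C1_on_def p_def q_def differentiable_imp_continuous_on)
  have diff: "u differentiable_on half_plane" "p' differentiable_on half_plane" "q' differentiable_on half_plane"
    "u differentiable_on closed_half_plane"
    using C1 C2 basis by (auto simp: C1_on_def C2_on_def p'_def q'_def)
  have cont': "continuous_on half_plane a" "continuous_on half_plane b" "continuous_on half_plane c"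
    using C2 basis by (auto simp: C1_on_def C2_on_def p'_def q'_def a_def b_def c_def)
  note H = half_plane_def closed_half_plane_def
  have u_x: "((\<lambda>t. u (t, y)) has_real_derivative p (x, y)) (at x)" if "y > 0" for x y
    unfolding p_def using diff that by (intro partial_derivative_x) (auto simp: H differentiable_on_def)
  have u_x': "((\<lambda>t. u (t, y)) has_real_derivative p' (x, y)) (at x)" if "y > 0" for x y
    unfolding p'_def using diff that by (intro partial_derivative_x) (auto simp: H differentiable_on_def)
  have u_y: "((\<lambda>t. u (x, t)) has_real_derivative q (x, y)) (at y)" if "y > 0" for x y
    unfolding q_def using diff that by (intro partial_derivative_y) (auto simp: H differentiable_on_def)
  have u_y': "((\<lambda>t. u (x, t)) has_real_derivative q' (x, y)) (at y)" if "y > 0" for x y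
    unfolding q'_def using diff that by (intro partial_derivative_y) (auto simp: H differentiable_on_def)
  have p_x': "((\<lambda>t. p' (t, y)) has_real_derivative a (x, y)) (at x)" if "y > 0" for x y
    unfolding a_def using diff that by (intro partial_derivative_x) (auto simp: H differentiable_on_def)
  have p_y': "((\<lambda>t. p' (x, t)) has_real_derivative b (x, y)) (at y)" if "y > 0" for x y
    unfolding b_def using diff that by (intro partial_derivative_y) (auto simp: H differentiable_on_def)
  have q_x': "((\<lambda>t. q' (t, y)) has_real_derivative c (x, y)) (at x)" if "y > 0" for x y
    unfolding c_def using diff that by (intro partial_derivative_x) (auto simp: H differentiable_on_def)
  have q_y': "((\<lambda>t. q' (x, t)) has_real_derivative - a (x, y)) (at y)" if "y > 0" for x y
  proof -
    have "laplacian half_plane u (x, y) = 0"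
      using sol that by (auto simp: boundary_reaction_solution_def H)
    then have "dir_deriv half_plane (0, 1) q' (x, y) = - a (x, y)"
      by (simp add: laplacian_def Basis_prod_def p'_def q'_def a_def)
    moreover have "((\<lambda>t. q' (x, t)) has_real_derivative dir_deriv half_plane (0, 1) q' (x, y)) (at y)"
      using diff that by (intro partial_derivative_y) (auto simp: H differentiable_on_def)
    ultimately show ?thesis by simp
  qed
  have pp: "p (x, y) = p' (x, y)" and qq: "q (x, y) = q' (x, y)" if "y > 0" for x y
    using DERIV_unique[OF u_x u_x'] DERIV_unique[OF u_y u_y'] that by blast+
  have bc: "b (x, y) = c (x, y)" if "y > 0" for x y
    by (rule mixed_partials_commute[OF u_x' u_y' p_y' q_x' cont'(3) that])
  have "half_plane_harmonic u p q a b"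
  proof unfold_locales
    fix x y :: real assume y: "y > 0"
    show "((\<lambda>t. p (t, y)) has_real_derivative a (x, y)) (at x)"
      "((\<lambda>t. q (t, y)) has_real_derivative b (x, y)) (at x)"
      using p_x'[OF y] q_x'[OF y] unfolding bc[OF y] by (simp_all only: pp[OF y] qq[OF y])
    show "((\<lambda>t. p (x, t)) has_real_derivative b (x, y)) (at y)"
      by (rule has_field_derivative_transform_within_open[OF p_y'[OF y], of "{0<..}"]) (use y in \<open>auto simp: pp\<close>)
    show "((\<lambda>t. q (x, t)) has_real_derivative - a (x, y)) (at y)"
      by (rule has_field_derivative_transform_within_open[OF q_y'[OF y], of "{0<..}"]) (use y in \<open>auto simp: qq\<close>)
  qed (fact cont cont' u_x u_y)+
  then show ?thesis by (auto simp: p_def q_def)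
qed

section \<open>Convexity of the potential near a well\<close>

lemma C2_holder_on_has_derivative:
  assumes "C2_holder_on \<alpha> S G" "t \<in> S"
  shows "(G has_real_derivative deriv_within S G t) (at t within S)"
    and "(deriv_within S G has_real_derivative deriv_within S (deriv_within S G) t) (at t within S)"
proof -
  have *: "(g has_real_derivative deriv_within S g t) (at t within S)" if "g differentiable_on S" for g
    using that assms(2)
    by (simp add: deriv_within_def has_real_derivative_iff_has_vector_derivative 
        differentiable_on_def vector_derivative_works)
  show "(G has_real_derivative deriv_within S G t) (at t within S)"
    and "(deriv_within S G has_real_derivative deriv_within S (deriv_within S G) t) (at t within S)"
    using assms(1) by (auto simp: C2_holder_on_def intro!: *)
qed

text \<open>
  Positivity of the second derivative at \<open>a\<close> makes \<open>G\<close> convex near \<open>a\<close>. Since \<open>G' a = 0\<close> is not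
  assumed, \<open>G t\<close> need not be comparable to \<open>(t - a)\<^sup>2\<close>.
\<close>

lemma le_deriv_within_times_near_left_end:
  fixes G :: "real \<Rightarrow> real"
  assumes ab: "a < b" and "\<alpha> > 0" and C2: "C2_holder_on \<alpha> {a..b} G"
    and Ga: "G a = 0" and pos: "deriv_within {a..b} (deriv_within {a..b} G) a > 0"
  obtains \<delta> where "\<delta> > 0" 
    "\<And>t. t \<in> {a..b} \<Longrightarrow> t \<le> a + \<delta> \<Longrightarrow> G t \<le> (t - a) * deriv_within {a..b} G t"
proof -
  define G' where "G' = deriv_within {a..b} G"
  define G'' where "G'' = deriv_within {a..b} G'"
  have c: "G'' a > 0" using pos by (simp add: G''_def G'_def)
  have "holder_on \<alpha> {a..b} G''" using C2 by (simp add: C2_holder_on_def G''_def G'_def)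
  then obtain C where "\<forall>s\<in>{a..b}. \<forall>t\<in>{a..b}. \<bar>G'' s - G'' t\<bar> \<le> C * \<bar>s - t\<bar> powr \<alpha>"
    unfolding holder_on_def by blast
  moreover have "a \<in> {a..b}" using ab by simp
  ultimately have C: "\<bar>G'' t - G'' a\<bar> \<le> C * \<bar>t - a\<bar> powr \<alpha>" if "t \<in> {a..b}" for t
    using that by blast
  \<comment> \<open>The Hoelder constant \<open>C\<close> may be nonpositive, so it is enlarged
    before dividing. Then \<open>\<delta>\<close> solves K \<delta>^\<alpha> = G''(a), the distance
    up to which G'' stays nonnegative.\<close>
  define K where "K = max C 1"
  define \<delta> where "\<delta> = (G'' a / K) powr (1 / \<alpha>)"
  have K: "K > 0" "C \<le> K" by (auto simp: K_def)
  have \<delta>: "\<delta> > 0" using c K by (simp add: \<delta>_def)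
  have G''_nonneg: "G'' t \<ge> 0" if "t \<in> {a..b}" "t \<le> a + \<delta>" for t
  proof -
    have "\<bar>t - a\<bar> powr \<alpha> \<le> \<delta> powr \<alpha>"
      using that \<open>\<alpha> > 0\<close> by (intro powr_mono2) auto
    also have "\<dots> = G'' a / K"
      using \<open>\<alpha> > 0\<close> c K by (simp add: \<delta>_def powr_powr)
    finally have "K * \<bar>t - a\<bar> powr \<alpha> \<le> G'' a" using K by (simp add: field_simps)
    moreover have "C * \<bar>t - a\<bar> powr \<alpha> \<le> K * \<bar>t - a\<bar> powr \<alpha>" 
      using K by (intro mult_right_mono) auto
    ultimately show ?thesis using C[OF that(1)] by linarith
  qed
  note deriv = C2_holder_on_has_derivative[OF C2, folded G'_def, folded G''_def]
  have G'_mono: "G' s \<le> G' t" if st: "a \<le> s" "s \<le> t" "t \<le> b" "t \<le> a + \<delta>" for s t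
  proof -
    have "\<exists>x\<in>{s..t}. G' t - G' s = G'' x * (t - s)"
      using st by (intro mvt_very_simple has_field_derivative_imp_has_derivative DERIV_subset[OF deriv(2)]) auto
    then obtain x where x: "x \<in> {s..t}" "G' t - G' s = G'' x * (t - s)" ..
    moreover have "G'' x * (t - s) \<ge> 0"
      using x(1) st by (intro mult_nonneg_nonneg G''_nonneg) auto
    ultimately show ?thesis by simp
  qed
  have "G t \<le> (t - a) * G' t" if t: "t \<in> {a..b}" "t \<le> a + \<delta>" for t
  proof -
    \<comment> \<open>The mean value theorem gives an intermediate slope of \<open>G\<close>, and
      monotonicity of \<open>G'\<close> bounds it by the slope at \<open>t\<close>.\<close>
    have "\<exists>x\<in>{a..t}. G t - G a = G' x * (t - a)"
      using t by (intro mvt_very_simple has_field_derivative_imp_has_derivative DERIV_subset[OF deriv(1)]) auto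
    then obtain x where x: "x \<in> {a..t}" "G t - G a = G' x * (t - a)" ..
    have "G' x * (t - a) \<le> G' t * (t - a)"
      using x(1) t by (intro mult_right_mono G'_mono) auto
    then show ?thesis using x(2) Ga by (simp add: mult.commute)
  qed
  with \<delta> show thesis by (intro that) (auto simp: G'_def)
qed

section \<open>Application to the boundary reaction problem\<close>

theorem theorem1p6:
  fixes G f :: "real \<Rightarrow> real" and u :: "real \<times> real \<Rightarrow> real" and \<alpha> :: real
  assumes "0 < \<alpha>" and "\<alpha> < 1"
    and "C2_holder_on \<alpha> {-1..1} G"
    and "\<And>t. t \<in> {-1..1} \<Longrightarrow> G t \<ge> 0"
    and "\<And>t. t \<in> {-1..1} \<Longrightarrow> G t = 0 \<longleftrightarrow> t = -1 \<or> t = 1"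
    and "deriv_within {-1..1} (deriv_within {-1..1} G) (-1) > 0"
    and "deriv_within {-1..1} (deriv_within {-1..1} G) 1 > 0"
    and "\<And>t. t \<in> {-1..1} \<Longrightarrow> f t = - deriv_within {-1..1} G t"
    and "boundary_reaction_solution f u"
    and "\<And>z. z \<in> closed_half_plane \<Longrightarrow> -1 \<le> u z \<and> u z \<le> 1"
    and "((\<lambda>x. u (x, 0)) \<longlongrightarrow> -1) at_top"
    and "((\<lambda>x. u (x, 0)) \<longlongrightarrow> -1) at_bot"
  shows "\<forall>z\<in>closed_half_plane. u z = -1"
proof
  fix z :: "real \<times> real" assume z: "z \<in> closed_half_plane"
  let ?I = "{- 1..1 :: real}"
  note C2 = assms(3) and G_nonneg = assms(4) and G_zero = assms(5) and sol = assms(9)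
  define p where "p = dir_deriv closed_half_plane (1, 0) u"
  define q where "q = dir_deriv closed_half_plane (0, 1) u"
  obtain a b where "half_plane_harmonic u p q a b"
    using half_plane_harmonic_solution[OF sol] by (auto simp: p_def q_def)
  then interpret half_plane_harmonic u p q a b .
  have u_I: "u (x, 0) \<in> ?I" for x
    using assms(10)[of "(x, 0)"] by (simp add: closed_half_plane_def)
  have bd: "\<bar>u z - (-1)\<bar> \<le> 2" if "z \<in> closed_half_plane" for z
    using assms(10)[OF that] by auto
  have diff: "u differentiable (at (x, 0) within closed_half_plane)" for x
    using sol by (auto simp: boundary_reaction_solution_def C1_on_def differentiable_on_def closed_half_plane_def)
  \<comment> \<open>Two signs cancel: the outer normal derivative is - u_y, and f = - G'.\<close>
  have q_eq: "q (x, 0) = deriv_within ?I G (u (x, 0))" for x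
  proof -
    let ?D = "frechet_derivative u (at (x, 0) within closed_half_plane)"
    have "(u has_derivative ?D) (at (x, 0) within closed_half_plane)"
      using diff by (simp add: frechet_derivative_works)
    then have "?D (- (0, 1)) = - ?D (0, 1)"
      by (rule linear_neg[OF has_derivative_linear])
    then have "normal_deriv u x = - q (x, 0)"
      by (simp add: normal_deriv_def dir_deriv_def q_def)
    moreover have "normal_deriv u x = - deriv_within ?I G (u (x, 0))"
      using sol assms(8)[OF u_I] by (simp add: boundary_reaction_solution_def)
    ultimately show ?thesis by simp
  qed
  define w where "w x = G (u (x, 0))" for x
  have w: "(w has_real_derivative p (x, 0) * q (x, 0)) (at x)" for x
  proof -
    have "((\<lambda>x. u (x, 0)) has_real_derivative p (x, 0)) (at x)"
      unfolding p_def by (rule partial_derivative_x[OF diff]) (simp add: closed_half_plane_def)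
    \<comment> \<open>At the values -1 and 1 the derivative of \<open>G\<close> is one-sided, so the
      chain rule is applied within the range of the boundary trace.\<close>
    moreover have "(G has_real_derivative deriv_within ?I G (u (x, 0)))
        (at (u (x, 0)) within range (\<lambda>x. u (x, 0)))"
      by (rule DERIV_subset[OF C2_holder_on_has_derivative(1)[OF C2 u_I]]) (use u_I in blast)
    ultimately have "(G \<circ> (\<lambda>x. u (x, 0)) has_real_derivative deriv_within ?I G (u (x, 0)) * p (x, 0)) (at x)"
      by (intro DERIV_image_chain)
    then show ?thesis by (simp add: w_def[abs_def] q_eq o_def mult.commute)
  qed
  obtain \<delta> where \<delta>: "\<delta> > 0"
      "\<And>t. t \<in> ?I \<Longrightarrow> t \<le> -1 + \<delta> \<Longrightarrow> G t \<le> (t - (-1)) * deriv_within ?I G t"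
    by (rule le_deriv_within_times_near_left_end[OF _ assms(1) C2]) (use assms(6) G_zero in auto)
  have "\<forall>\<^sub>F x in at_top. u (x, 0) < -1 + \<delta>" "\<forall>\<^sub>F x in at_bot. u (x, 0) < -1 + \<delta>"
    using order_tendstoD(2)[OF assms(11)] order_tendstoD(2)[OF assms(12)] \<delta>(1) by auto
  then obtain r1 r2 where r12: "\<And>x. x \<ge> r1 \<Longrightarrow> u (x, 0) < -1 + \<delta>" "\<And>x. x \<le> r2 \<Longrightarrow> u (x, 0) < -1 + \<delta>"
    by (auto simp: eventually_at_top_linorder eventually_at_bot_linorder)
  define r where "r = max 1 (max r1 (- r2))"
  have r: "r > 0" by (simp add: r_def)
  have w_le: "w x \<le> (u (x, 0) - (-1)) * q (x, 0)" if "\<bar>x\<bar> \<ge> r" for x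
  proof -
    have "x \<ge> r1 \<or> x \<le> r2" using that by (auto simp: r_def abs_if split: if_splits)
    then have "u (x, 0) \<le> -1 + \<delta>" using r12 less_imp_le by blast
    then show ?thesis unfolding w_def q_eq by (rule \<delta>(2)[OF u_I])
  qed
  have w_nonneg: "w x \<ge> 0" for x
    using G_nonneg[OF u_I] by (simp add: w_def)
  note potential = boundary_potential_vanishes[OF bd w w_nonneg r w_le]
  have u_pm: "u (x, 0) = -1 \<or> u (x, 0) = 1" for x
    using potential(1)[of x] G_zero[OF u_I] by (simp add: w_def)
  \<comment> \<open>The continuous trace takes only the values -1 and 1 and is negative far out; a
    value 1 anywhere would force the value 0 in between.\<close>
  have boundary: "u (x, 0) = -1" for x
  proof (rule ccontr)
    assume "u (x, 0) \<noteq> -1"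
    then have x: "1 \<in> range (\<lambda>x. u (x, 0))" using u_pm[of x] by (metis rangeI)
    have "\<forall>\<^sub>F x in at_top. u (x, 0) < 0"
      using order_tendstoD(2)[OF assms(11)] by simp
    then obtain x' where "u (x', 0) < 0"
      by (auto simp: eventually_at_top_linorder)
    then have x': "-1 \<in> range (\<lambda>x. u (x, 0))" using u_pm[of x'] by (metis rangeI not_one_less_zero)
    have "connected (range (\<lambda>x. u (x, 0)))"
      by (intro connected_continuous_image continuous_on_boundary) auto
    from connected_contains_Icc[OF this x' x] have "0 \<in> range (\<lambda>x. u (x, 0))" by auto
    then obtain y where "0 = u (y, 0)" by (rule rangeE)
    then show False using u_pm[of y] by simp
  qed
  from potential(2) obtain M where "\<forall>n. energy (r * 2 ^ n) \<le> M" ..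
  then show "u z = -1"
    by (intro eq_boundary_value_if_energy_bounded[OF bd boundary r _ z, of M]) simp_all
qed

end
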